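(* Let $G$ be a connected graph with no full vertex, and let $X=\{v\in V(G)\mid G-v \text{ is not connected}\}$. Then $CC(G)=2$ if and only if $X$ is a connected dominating set of $G$.
   Context: All graphs are finite and simple, with nonempty vertex set. A full vertex of $G$ is a vertex of degree $|V(G)|-1$. A set $S\subseteq V(G)$ is a dominating set of $G$ if every vertex of $V(G)\setminus S$ has a neighbour in $S$; it is a connected dominating set if moreover the induced subgraph $G[S]$ is connected. Two disjoint vertex sets $A_1,A_2$ form a connected coalition of $G$ if $A_1\cup A_2$ is a connected dominating set of $G$ but neither $A_1$ nor $A_2$ is a connected dominating set of $G$. A connected coalition partition of $G$ is a partition $\Phi$ of $V(G)$ (into nonempty sets) such that each $A\in\Phi$ either is $\{v\}$ for some full vertex $v$ of $G$, or forms a connected coalition of $G$ with another set in $\Phi$. The connected coalition number $CC(G)$ is the maximum cardinality of a connected coalition partition of $G$, with $CC(G)=0$ if none exists. *)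

theory Defs
  imports "Graph_Theory.Graph_Theory" "HOL-Library.Disjoint_Sets"
begin

text \<open>
  Finite simple graphs are the symmetric digraphs without loops and parallel arcs given by the
  locale \<open>graph\<close>: an edge is a pair of opposite arcs, so the degree of a vertex is its out-degree.
  A graph without vertices is not \<open>connected\<close>.
\<close>

definition full_vertex :: "('a,'b) pre_digraph \<Rightarrow> 'a \<Rightarrow> bool" where
  "full_vertex G v \<longleftrightarrow> v \<in> verts G \<and> out_degree G v = card (verts G) - 1"

definition dominating_set :: "('a,'b) pre_digraph \<Rightarrow> 'a set \<Rightarrow> bool" where
  "dominating_set G S \<longleftrightarrow>
     S \<subseteq> verts G \<and> (\<forall>u \<in> verts G - S. \<exists>v \<in> S. u \<rightarrow>\<^bsub>G\<^esub> v)"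

definition connected_dominating_set :: "('a,'b) pre_digraph \<Rightarrow> 'a set \<Rightarrow> bool" where
  "connected_dominating_set G S \<longleftrightarrow> dominating_set G S \<and> connected (G \<restriction> S)"

definition connected_coalition :: "('a,'b) pre_digraph \<Rightarrow> 'a set \<Rightarrow> 'a set \<Rightarrow> bool" where
  "connected_coalition G A B \<longleftrightarrow>
     A \<subseteq> verts G \<and> B \<subseteq> verts G \<and> A \<inter> B = {} \<and>
     connected_dominating_set G (A \<union> B) \<and>
     \<not> connected_dominating_set G A \<and> \<not> connected_dominating_set G B"

definition connected_coalition_partition ::
    "('a,'b) pre_digraph \<Rightarrow> 'a set set \<Rightarrow> bool" where
  "connected_coalition_partition G \<Phi> \<longleftrightarrow>
     partition_on (verts G) \<Phi> \<and>
     (\<forall>A \<in> \<Phi>. (\<exists>v. full_vertex G v \<and> A = {v}) \<or>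
               (\<exists>B \<in> \<Phi>. B \<noteq> A \<and> connected_coalition G A B))"

text \<open>A finite vertex set has finitely many partitions, so the maximum below is a genuine one.\<close>

definition connected_coalition_number :: "('a,'b) pre_digraph \<Rightarrow> nat" where
  "connected_coalition_number G =
     (if \<exists>\<Phi>. connected_coalition_partition G \<Phi>
      then Max {card \<Phi> | \<Phi>. connected_coalition_partition G \<Phi>}
      else 0)"

end

theory Submission
  imports Defs
begin

(*
  Connected dominating sets (CDS) are closed under supersets, and v lies in X exactly when V - {v} is
  not a CDS; so every CDS contains X.
  If X is a CDS, a coalition partition has no part disjoint from X (its partner would contain X), yet
  any third part is disjoint from X, so exactly two parts remain.
  If X is not a CDS, take a minimal CDS S and v in S - X. When V - S is not a CDS, the three sets
  {v}, S - {v}, V - S form a coalition partition with S - {v} as common partner. Otherwise V - S is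
  itself partitioned into coalitions, by repeatedly splitting off a minimal CDS into two pieces, and
  adding {v}, S - {v} gives at least four parts.
*)

section \<open>Connectivity of induced subgraphs and closure under supersets\<close>

lemma (in wf_digraph) del_vert_eq_induce_subgraph: "del_vert v = G \<restriction> (verts G - {v})"
  by (auto simp: del_vert_def induce_subgraph_def)

lemma (in wf_digraph) induce_subgraph_verts_eq: "G \<restriction> verts G = G"
  by (intro pre_digraph.equality) auto

lemma (in sym_digraph) symmetric_induce_subgraph: "symmetric (G \<restriction> S)"
  using sym_arcs unfolding symmetric_conv by simp metis

text \<open>Symmetry makes weak and strong connectivity agree, so connectedness can be handled
  through directed reachability, which passes on to larger induced subgraphs.\<close>

lemma (in sym_digraph) connected_induce_subgraph_iff:
  "connected (G \<restriction> S) \<longleftrightarrow> S \<noteq> {} \<and> (\<forall>u\<in>S. \<forall>v\<in>S. u \<rightarrow>\<^sup>*\<^bsub>G \<restriction> S\<^esub> v)"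
proof -
  interpret S: wf_digraph "G \<restriction> S" ..
  show ?thesis
    using S.symmetric_connected_imp_strongly_connected[OF symmetric_induce_subgraph]
      S.reachable_mk_symmetric_eq[OF symmetric_induce_subgraph]
    by (auto simp: strongly_connected_def connected_def)
qed

text \<open>Each vertex of \<open>T\<close> lies in \<open>S\<close> or is adjacent to it, so any
  two vertices of \<open>T\<close> are linked by a walk through \<open>S\<close>.\<close>

lemma (in sym_digraph) connected_dominating_set_superset:
  assumes "connected_dominating_set G S" "S \<subseteq> T" "T \<subseteq> verts G"
  shows "connected_dominating_set G T"
proof -
  interpret T: wf_digraph "G \<restriction> T" ..
  have S0: "S \<noteq> {}" "\<And>u v. u \<in> S \<Longrightarrow> v \<in> S \<Longrightarrow> u \<rightarrow>\<^sup>*\<^bsub>G \<restriction> S\<^esub> v"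
    using assms(1) unfolding connected_dominating_set_def connected_induce_subgraph_iff by simp_all
  note S = S0(1) reachable_induce_ss[OF S0(2) assms(2)]
  have near: "\<exists>s\<in>S. u \<rightarrow>\<^sup>*\<^bsub>G \<restriction> T\<^esub> s" if u: "u \<in> T" for u
  proof (cases "u \<in> S")
    case False
    then obtain s where "s \<in> S" "u \<rightarrow> s"
      using assms u unfolding connected_dominating_set_def dominating_set_def by blast
    moreover have "u \<rightarrow>\<^bsub>G \<restriction> T\<^esub> s"
      using \<open>u \<rightarrow> s\<close> \<open>s \<in> S\<close> assms(2) u by (auto simp: arcs_ends_conv)
    ultimately show ?thesis by blast
  qed (use S u in blast)
  have "u \<rightarrow>\<^sup>*\<^bsub>G \<restriction> T\<^esub> v" if uv: "u \<in> T" "v \<in> T" for u v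
  proof -
    obtain s t where st: "s \<in> S" "t \<in> S" "u \<rightarrow>\<^sup>*\<^bsub>G \<restriction> T\<^esub> s" "v \<rightarrow>\<^sup>*\<^bsub>G \<restriction> T\<^esub> t"
      using near uv by blast
    have "t \<rightarrow>\<^sup>*\<^bsub>G \<restriction> T\<^esub> v"
      using symmetric_reachable[OF symmetric_induce_subgraph] st by blast
    with st S(2)[of s t] show ?thesis by (blast intro: T.reachable_trans)
  qed
  then have "connected (G \<restriction> T)"
    unfolding connected_induce_subgraph_iff using S(1) assms(2) by blast
  moreover have "dominating_set G T"
    using assms unfolding connected_dominating_set_def dominating_set_def by blast
  ultimately show ?thesis by (simp add: connected_dominating_set_def)
qed

section \<open>Singletons and deleted vertices\<close>

lemma (in graph) full_vertex_if_connected_dominating_singleton: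
  assumes "connected_dominating_set G {v}"
  shows "full_vertex G v"
proof -
  have v: "v \<in> verts G" and dom: "\<And>u. u \<in> verts G \<Longrightarrow> u \<noteq> v \<Longrightarrow> u \<rightarrow> v"
    using assms by (auto simp: connected_dominating_set_def dominating_set_def)
  \<comment> \<open>Degree counts arcs, not neighbours: the absence of parallel arcs gives
    injectivity, and reversing the dominating arcs \<open>u \<rightarrow> v\<close> gives
    surjectivity.\<close>
  have "bij_betw (head G) (out_arcs G v) (verts G - {v})"
    unfolding bij_betw_def
  proof
    show "inj_on (head G) (out_arcs G v)"
      by (auto intro!: inj_onI no_multi_arcs simp: arc_to_ends_def)
    have "u \<in> head G ` out_arcs G v" if "u \<in> verts G" "u \<noteq> v" for u
    proof -
      have "v \<rightarrow> u"
        using dom that arcs_ends_symmetric[OF sym_arcs] by blast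
      then show ?thesis by (auto simp: arcs_ends_conv)
    qed
    then show "head G ` out_arcs G v = verts G - {v}"
      by (auto dest: no_loops)
  qed
  then have "out_degree G v = card (verts G - {v})"
    unfolding out_degree_def by (rule bij_betw_same_card)
  then show ?thesis using v by (simp add: full_vertex_def)
qed

lemma (in wf_digraph) not_connected_dominating_empty: "\<not> connected_dominating_set G {}"
  by (simp add: connected_dominating_set_def connected_conv)

lemma (in wf_digraph) connected_dominating_set_verts:
  "connected G \<Longrightarrow> connected_dominating_set G (verts G)"
  by (simp add: connected_dominating_set_def dominating_set_def induce_subgraph_verts_eq)

text \<open>Only domination of \<open>v\<close> needs an argument: a connected graph with a second
  vertex gives \<open>v\<close> a neighbour.\<close>

lemma (in graph) connected_dominating_set_del_vert_iff:
  assumes "connected G" and v: "v \<in> verts G" and "\<not> full_vertex G v"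
  shows "connected_dominating_set G (verts G - {v}) \<longleftrightarrow> connected (del_vert v)"
proof -
  have "\<exists>u\<in>verts G - {v}. v \<rightarrow> u"
  proof -
    \<comment> \<open>Otherwise \<open>{v}\<close> would be the whole connected graph, hence a
      connected dominating set, and \<open>v\<close> would be full.\<close>
    have "verts G \<noteq> {v}"
      using connected_dominating_set_verts full_vertex_if_connected_dominating_singleton assms
      by force
    then obtain w where w: "w \<in> verts G" "w \<noteq> v" using v by blast
    have "v \<rightarrow>\<^sup>* w"
      using symmetric_connected_imp_strongly_connected[OF sym_arcs assms(1)] v w by auto
    then obtain u where "v \<rightarrow> u"
      using w(2) reachable_rtranclI[of G v w] by (metis converse_rtranclE)
    then show ?thesis using adj_not_same by (metis Diff_iff adj_in_verts(2) singletonD)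
  qed
  then have "dominating_set G (verts G - {v})"
    using v by (auto simp: dominating_set_def)
  then show ?thesis
    by (simp add: connected_dominating_set_def del_vert_eq_induce_subgraph)
qed

lemma (in fin_digraph) minimal_connected_dominating_subset:
  assumes "connected_dominating_set G C"
  obtains S where "S \<subseteq> C" "connected_dominating_set G S"
    "\<And>T. T \<subset> S \<Longrightarrow> \<not> connected_dominating_set G T"
proof -
  have "finite {S. connected_dominating_set G S}"
    by (rule finite_subset[of _ "Pow (verts G)"])
      (auto simp: connected_dominating_set_def dominating_set_def)
  from finite_has_minimal2[OF this, of C] assms that show thesis
    by (auto simp: psubset_eq)
qed

section \<open>Building coalition partitions of vertex subsets\<close>

lemma connected_coalition_commute: "connected_coalition G A B \<longleftrightarrow> connected_coalition G B A"
  by (auto simp: connected_coalition_def Un_commute Int_commute)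

text \<open>Only the partitioned set is relativised to \<open>C\<close>; coalitions are still taken
  in all of \<open>G\<close>. This lets partitions of disjoint vertex sets be put together
  recursively.\<close>

definition coalition_partition_of :: "('a,'b) pre_digraph \<Rightarrow> 'a set \<Rightarrow> 'a set set \<Rightarrow> bool" where
  "coalition_partition_of G C \<Phi> \<longleftrightarrow>
     partition_on C \<Phi> \<and> (\<forall>A\<in>\<Phi>. \<exists>B\<in>\<Phi>. B \<noteq> A \<and> connected_coalition G A B)"

lemma coalition_partition_of_insert2:
  assumes \<Psi>: "coalition_partition_of G R \<Psi>" and coal: "connected_coalition G A B"
    and ne: "A \<noteq> {}" "B \<noteq> {}" and disj: "A \<inter> R = {}" "B \<inter> R = {}"
  shows "coalition_partition_of G (A \<union> B \<union> R) (insert A (insert B \<Psi>))"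
    and "finite \<Psi> \<Longrightarrow> card (insert A (insert B \<Psi>)) = card \<Psi> + 2"
proof -
  have AB: "A \<inter> B = {}" using coal by (simp add: connected_coalition_def)
  then have "A \<noteq> B" using ne by blast
  have part: "partition_on R \<Psi>"
    and partner: "\<And>C. C \<in> \<Psi> \<Longrightarrow> \<exists>D\<in>\<Psi>. D \<noteq> C \<and> connected_coalition G C D"
    using \<Psi> by (auto simp: coalition_partition_of_def)
  have U: "\<Union>\<Psi> = R" using part by (simp add: partition_on_def)
  have "A \<notin> \<Psi>" "B \<notin> \<Psi>" using U ne disj by blast+
  then show "finite \<Psi> \<Longrightarrow> card (insert A (insert B \<Psi>)) = card \<Psi> + 2"
    using \<open>A \<noteq> B\<close> by simp
  have "B \<union> R - B = R" "A \<union> B \<union> R - A = B \<union> R" using AB disj by blast+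
  moreover have "disjnt B (\<Union>\<Psi>)" "disjnt A (\<Union>(insert B \<Psi>))"
    using AB disj unfolding Union_insert U disjnt_def by blast+
  ultimately have "partition_on (A \<union> B \<union> R) (insert A (insert B \<Psi>))"
    using part ne by (simp add: partition_on_insert Un_assoc)
  moreover have "\<exists>D\<in>insert A (insert B \<Psi>). D \<noteq> C \<and> connected_coalition G C D"
    if C: "C \<in> insert A (insert B \<Psi>)" for C
  proof -
    consider "C = A" | "C = B" | "C \<in> \<Psi>" using C by blast
    then show ?thesis
    proof cases
      case 1
      then show ?thesis using coal \<open>A \<noteq> B\<close> by (intro bexI[of _ B]) auto
    next
      case 2
      then show ?thesis using coal[THEN connected_coalition_commute[THEN iffD1]] \<open>A \<noteq> B\<close>
        by (intro bexI[of _ A]) auto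
    next
      case 3
      then show ?thesis using partner by blast
    qed
  qed
  ultimately show "coalition_partition_of G (A \<union> B \<union> R) (insert A (insert B \<Psi>))"
    by (simp add: coalition_partition_of_def)
qed

lemma coalition_partition_of_pair:
  assumes "connected_coalition G A B" "A \<noteq> {}" "B \<noteq> {}"
  shows "coalition_partition_of G (A \<union> B) {A, B}" "card {A, B} = 2"
proof -
  \<comment> \<open>A pair extends the empty partition of the empty set.\<close>
  have "coalition_partition_of G {} {}"
    by (simp add: coalition_partition_of_def partition_on_empty)
  from coalition_partition_of_insert2[OF this assms]
  show "coalition_partition_of G (A \<union> B) {A, B}" "card {A, B} = 2" by simp_all
qed

lemma coalition_partition_of_common_partner:
  assumes "connected_coalition G A B" "connected_coalition G A C"
    and "A \<noteq> {}" "B \<noteq> {}" "C \<noteq> {}" "B \<inter> C = {}"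
  shows "coalition_partition_of G (A \<union> B \<union> C) {A, B, C}" "card {A, B, C} = 3"
proof -
  have disj: "A \<inter> B = {}" "A \<inter> C = {}"
    using assms(1,2) by (auto simp: connected_coalition_def)
  then have ne: "A \<noteq> B" "A \<noteq> C" "B \<noteq> C" using assms(3-6) by blast+
  then show "card {A, B, C} = 3" by simp
  have "partition_on (A \<union> B \<union> C) {A, B, C}"
  proof (rule partition_onI)
    show "disjnt p q" if "p \<in> {A, B, C}" "q \<in> {A, B, C}" "p \<noteq> q" for p q
      using that disj assms(6) unfolding disjnt_def by blast
  qed (use assms(3-5) in auto)
  moreover have "connected_coalition G B A" "connected_coalition G C A"
    using assms(1,2) connected_coalition_commute by blast+
  ultimately show "coalition_partition_of G (A \<union> B \<union> C) {A, B, C}"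
    using assms(1) ne by (simp add: coalition_partition_of_def)
qed

section \<open>Coalition partitions from minimal connected dominating sets\<close>

lemma (in graph) minimal_connected_dominating_set_coalition:
  assumes nofull: "\<And>v. \<not> full_vertex G v" and S: "connected_dominating_set G S"
    and min: "\<And>T. T \<subset> S \<Longrightarrow> \<not> connected_dominating_set G T" and a: "a \<in> S"
  shows "connected_coalition G {a} (S - {a})" and "S - {a} \<noteq> {}"
proof -
  have single: "\<not> connected_dominating_set G {a}"
    using nofull full_vertex_if_connected_dominating_singleton by blast
  have "S \<noteq> {a}" using S single by metis
  then show "S - {a} \<noteq> {}" using a by blast
  have "\<not> connected_dominating_set G (S - {a})" using min a by blast
  moreover have "{a} \<union> (S - {a}) = S" using a by blast
  moreover have "S \<subseteq> verts G"
    using S by (simp add: connected_dominating_set_def dominating_set_def)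
  ultimately show "connected_coalition G {a} (S - {a})"
    using S single a unfolding connected_coalition_def by auto
qed

text \<open>Strong induction on \<open>card C\<close>: a minimal connected dominating set
  \<open>S\<close> inside \<open>C\<close> splits into \<open>{a}\<close> and
  \<open>S - {a}\<close>, and the remainder \<open>R\<close> is either partitioned recursively, kept
  as a third part, or merged into \<open>{a}\<close>.\<close>

lemma (in graph) coalition_partition_of_exists:
  assumes nofull: "\<And>v. \<not> full_vertex G v" and "connected_dominating_set G C"
  shows "\<exists>\<Phi>. coalition_partition_of G C \<Phi> \<and> 2 \<le> card \<Phi>"
  using assms(2)
proof (induction "card C" arbitrary: C rule: less_induct)
  case less
  let ?P = "connected_dominating_set G"
  have single: "\<not> ?P {v}" for v
    using nofull full_vertex_if_connected_dominating_singleton by blast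
  obtain S where S: "S \<subseteq> C" "?P S" "\<And>T. T \<subset> S \<Longrightarrow> \<not> ?P T"
    using minimal_connected_dominating_subset[OF less.prems] by blast
  have CV: "C \<subseteq> verts G"
    using less.prems by (simp add: connected_dominating_set_def dominating_set_def)
  then have "finite C" by (rule finite_subset) simp
  obtain a where a: "a \<in> S" using S(2) not_connected_dominating_empty by (cases "S = {}") auto
  note coal = minimal_connected_dominating_set_coalition(1)[OF nofull S(2,3) a]
  note Sa = minimal_connected_dominating_set_coalition(2)[OF nofull S(2,3) a]
  define R where "R = C - S"
  have disj: "{a} \<inter> R = {}" "(S - {a}) \<inter> R = {}" and C: "{a} \<union> (S - {a}) \<union> R = C"
    using a S(1) by (auto simp: R_def)
  consider "?P R" | "\<not> ?P R" "?P ({a} \<union> R)" | "\<not> ?P ({a} \<union> R)"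
    by blast
  then show ?case
  proof cases
    case 1
    have "card R < card C"
      unfolding R_def using S(1) a \<open>finite C\<close> by (intro psubset_card_mono) auto
    from less.hyps[OF this 1] obtain \<Psi> where \<Psi>: "coalition_partition_of G R \<Psi>" "2 \<le> card \<Psi>"
      by blast
    \<comment> \<open>An infinite set would have \<open>card\<close> 0.\<close>
    have "finite \<Psi>" using \<Psi>(2) by (metis card.infinite not_numeral_le_zero)
    then show ?thesis
      using coalition_partition_of_insert2[OF \<Psi>(1) coal _ Sa disj] C \<Psi>(2) by force
  next
    case 2
    \<comment> \<open>With \<open>R\<close> empty, the case assumption would make the singleton
      \<open>{a}\<close> a connected dominating set.\<close>
    then have "R \<noteq> {}" using single by force
    moreover have "connected_coalition G {a} R"
      using 2 single disj a S(1) CV unfolding connected_coalition_def R_def by blast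
    \<comment> \<open>Here \<open>{a}\<close> is the common partner of \<open>S - {a}\<close> and
      \<open>R\<close>.\<close>
    ultimately show ?thesis
      using coalition_partition_of_common_partner[OF coal, of R] Sa disj(2) C by force
  next
    case 3
    \<comment> \<open>Since \<open>{a} \<union> R\<close> is not a connected dominating set either,
      it can serve as one part, leaving exactly two.\<close>
    have "{a} \<union> R \<union> (S - {a}) = C" using C by blast
    moreover have "\<not> ?P (S - {a})" using coal by (simp add: connected_coalition_def)
    ultimately have "connected_coalition G ({a} \<union> R) (S - {a})"
      using 3 less.prems CV disj unfolding connected_coalition_def by auto
    from coalition_partition_of_pair[OF this _ Sa] show ?thesis
      using \<open>{a} \<union> R \<union> (S - {a}) = C\<close> by (metis insert_is_Un insert_not_empty order_refl)
  qed
qed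

lemma connected_coalition_partition_if_partition_of:
  "coalition_partition_of G (verts G) \<Phi> \<Longrightarrow> connected_coalition_partition G \<Phi>"
  by (simp add: coalition_partition_of_def connected_coalition_partition_def)

section \<open>The coalition number and the two directions of the equivalence\<close>

lemma (in graph) card_le_connected_coalition_number:
  assumes "connected_coalition_partition G \<Phi>"
  shows "card \<Phi> \<le> connected_coalition_number G"
proof -
  have "finite {\<Phi>. connected_coalition_partition G \<Phi>}"
    by (rule finite_subset[OF _ finitely_many_partition_on[OF finite_verts]])
      (auto simp: connected_coalition_partition_def)
  then have "finite {card \<Phi> | \<Phi>. connected_coalition_partition G \<Phi>}"
    by simp
  then show ?thesis
    unfolding connected_coalition_number_def using assms by (auto intro: Max_ge)
qed

lemma (in graph) connected_coalition_number_ge_3: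
  assumes conn: "connected G" and nofull: "\<And>v. \<not> full_vertex G v"
    and X: "X = {v \<in> verts G. \<not> connected (del_vert v)}"
    and nX: "\<not> connected_dominating_set G X"
  shows "3 \<le> connected_coalition_number G"
proof -
  let ?P = "connected_dominating_set G"
  obtain S where S: "S \<subseteq> verts G" "?P S" "\<And>T. T \<subset> S \<Longrightarrow> \<not> ?P T"
    using minimal_connected_dominating_subset[OF connected_dominating_set_verts[OF conn]] by blast
  \<comment> \<open>Otherwise \<open>X\<close>, as a superset of \<open>S\<close>, would be a
    connected dominating set.\<close>
  have "\<not> S \<subseteq> X"
    using connected_dominating_set_superset[OF S(2)] nX X by blast
  then obtain v where v: "v \<in> S" "v \<notin> X" by blast
  then have Pv: "?P (verts G - {v})"
    using connected_dominating_set_del_vert_iff[OF conn _ nofull] S(1) X by blast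
  note coal = minimal_connected_dominating_set_coalition(1)[OF nofull S(2,3) v(1)]
  note Sv = minimal_connected_dominating_set_coalition(2)[OF nofull S(2,3) v(1)]
  define C where "C = verts G - S"
  have "C \<noteq> {}"
  proof
    assume "C = {}"
    \<comment> \<open>If \<open>S\<close> were all of \<open>verts G\<close>, then
      \<open>verts G - {v}\<close> would contradict its minimality, because
      \<open>v \<notin> X\<close>.\<close>
    then have "verts G - {v} \<subset> S" using v S(1) by (auto simp: C_def)
    then show False using S(3) Pv by blast
  qed
  have disj: "{v} \<inter> C = {}" "(S - {v}) \<inter> C = {}" and V: "{v} \<union> (S - {v}) \<union> C = verts G"
    using v(1) S(1) by (auto simp: C_def)
  have "\<exists>\<Phi>. coalition_partition_of G (verts G) \<Phi> \<and> 3 \<le> card \<Phi>"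
  proof (cases "?P C")
    case False
    have "(S - {v}) \<union> C = verts G - {v}" using S(1) v by (auto simp: C_def)
    moreover have "\<not> ?P (S - {v})" using coal by (simp add: connected_coalition_def)
    ultimately have coalC: "connected_coalition G (S - {v}) C"
      using Pv False S(1) disj(2) by (auto simp: connected_coalition_def C_def)
    have "S - {v} \<union> {v} \<union> C = verts G" using V by blast
    then show ?thesis
      using coalition_partition_of_common_partner[OF
          coal[THEN connected_coalition_commute[THEN iffD1]] coalC Sv _ \<open>C \<noteq> {}\<close> disj(1)]
      by (metis insert_not_empty order_refl)
  next
    case True
    from coalition_partition_of_exists[OF nofull this] obtain \<Psi> where
      \<Psi>: "coalition_partition_of G C \<Psi>" "2 \<le> card \<Psi>" by blast
    have "finite \<Psi>" using \<Psi>(2) by (metis card.infinite not_numeral_le_zero)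
    then show ?thesis
      using coalition_partition_of_insert2[OF \<Psi>(1) coal _ Sv disj] V \<Psi>(2) by force
  qed
  then obtain \<Phi> where "coalition_partition_of G (verts G) \<Phi>" "3 \<le> card \<Phi>" by blast
  then show ?thesis
    using card_le_connected_coalition_number[OF connected_coalition_partition_if_partition_of] le_trans by blast
qed

lemma (in graph) connected_coalition_number_eq_2:
  assumes conn: "connected G" and nofull: "\<And>v. \<not> full_vertex G v"
    and X: "X = {v \<in> verts G. \<not> connected (del_vert v)}"
    and PX: "connected_dominating_set G X"
  shows "connected_coalition_number G = 2"
proof -
  let ?P = "connected_dominating_set G"
  \<comment> \<open>A set \<open>S\<close> missing some \<open>v \<in> X\<close> lies in
    \<open>verts G - {v}\<close>, which would then inherit the property from
    \<open>S\<close>.\<close>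
  have sub: "X \<subseteq> S" if "?P S" for S
  proof
    fix v assume "v \<in> X"
    then have "\<not> ?P (verts G - {v})"
      using connected_dominating_set_del_vert_iff[OF conn _ nofull] X by blast
    moreover have "S \<subseteq> verts G"
      using that by (simp add: connected_dominating_set_def dominating_set_def)
    ultimately show "v \<in> S"
      using connected_dominating_set_superset[OF that, of "verts G - {v}"] by blast
  qed
  have XV: "X \<subseteq> verts G" using X by blast
  have card2: "card \<Phi> = 2" if \<Phi>: "connected_coalition_partition G \<Phi>" for \<Phi>
  proof -
    have part: "partition_on (verts G) \<Phi>"
      and partner: "\<And>A. A \<in> \<Phi> \<Longrightarrow> \<exists>B\<in>\<Phi>. B \<noteq> A \<and> connected_coalition G A B"
      using \<Phi> nofull by (auto simp: connected_coalition_partition_def)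
    have V: "A \<subseteq> verts G" if "A \<in> \<Phi>" for A
      using part that by (auto simp: partition_on_def)
    have disj: "A \<inter> B = {}" if "A \<in> \<Phi>" "B \<in> \<Phi>" "A \<noteq> B" for A B
      using part that by (auto simp: partition_on_def disjoint_def)
    have meets: "A \<inter> X \<noteq> {}" if A: "A \<in> \<Phi>" for A
    proof
      assume "A \<inter> X = {}"
      obtain B where B: "B \<in> \<Phi>" "connected_coalition G A B" using partner[OF A] by blast
      then have "X \<subseteq> A \<union> B" "\<not> ?P B" using sub by (auto simp: connected_coalition_def)
      then have "X \<subseteq> B" using \<open>A \<inter> X = {}\<close> by blast
      then show False
        using connected_dominating_set_superset[OF PX _ V[OF B(1)]] \<open>\<not> ?P B\<close> by blast
    qed
    have "\<Phi> \<noteq> {}"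
      using part conn by (auto simp: partition_on_def connected_conv)
    then obtain A where A: "A \<in> \<Phi>" by blast
    obtain B where B: "B \<in> \<Phi>" "B \<noteq> A" "connected_coalition G A B" using partner[OF A] by blast
    then have "X \<subseteq> A \<union> B" using sub by (auto simp: connected_coalition_def)
    \<comment> \<open>A third part would be disjoint from \<open>A \<union> B\<close>, hence from
      \<open>X\<close>, contradicting \<open>meets\<close>.\<close>
    then have "C = A \<or> C = B" if "C \<in> \<Phi>" for C
      using meets[OF that] disj[OF that A] disj[OF that B(1)] by blast
    then have "\<Phi> = {A, B}" using A B by blast
    then show ?thesis using B(2) by simp
  qed
  \<comment> \<open>The bound so far concerns every partition; one must still exist, or the number
    would take its default value 0. The witness pairs \<open>{x}\<close> with its complement, which
    fails to be a connected dominating set because \<open>x \<in> X\<close>.\<close>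
  obtain x where x: "x \<in> X" using PX not_connected_dominating_empty by (cases "X = {}") auto
  have xV: "x \<in> verts G" using x XV by blast
  have nsingle: "\<not> ?P {x}" using nofull full_vertex_if_connected_dominating_singleton by blast
  let ?B = "verts G - {x}"
  have nB: "\<not> ?P ?B" using sub x by blast
  have "connected_coalition G {x} ?B"
    using nsingle nB xV connected_dominating_set_verts[OF conn]
    by (simp add: connected_coalition_def insert_absorb)
  moreover have "?B \<noteq> {}"
  proof
    assume "?B = {}"
    then have "X = {x}" using x XV by blast
    then show False using PX nsingle by simp
  qed
  ultimately have ex: "connected_coalition_partition G {{x}, ?B}"
    using coalition_partition_of_pair[of G "{x}" ?B] xV
    by (intro connected_coalition_partition_if_partition_of) (simp add: insert_absorb)
  then have "{card \<Phi> | \<Phi>. connected_coalition_partition G \<Phi>} = {2}"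
    using card2 by (auto intro!: exI[of _ "{{x}, ?B}"])
  then show ?thesis using ex by (auto simp: connected_coalition_number_def)
qed

theorem theorem1p5:
  fixes G :: "('a,'b) pre_digraph" and X :: "'a set"
  assumes "graph G"
    and "connected G"
    and "\<not> (\<exists>v. full_vertex G v)"
    and "X = {v \<in> verts G. \<not> connected (pre_digraph.del_vert G v)}"
  shows "connected_coalition_number G = 2 \<longleftrightarrow> connected_dominating_set G X"
proof -
  interpret graph G by fact
  show ?thesis
    using connected_coalition_number_ge_3[of X] connected_coalition_number_eq_2[of X] assms
    by fastforce
qed

end
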